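(* Let $p$ be a prime and let $k$ be an even positive integer. Then $$\frac{\eta(4pz)^{4k}}{\eta(2pz)^{2k}}\in M_k(\Gamma_0(4p)).$$
   Context: $\eta(z)=q^{1/24}\prod_{n\ge1}(1-q^n)$ with $q=e^{2\pi i z}$, for $z$ in the upper half plane. $\Gamma_0(N)$ is the group of matrices in $\mathrm{SL}_2(\mathbb Z)$ congruent to $\begin{pmatrix}*&*\\0&*\end{pmatrix}$ modulo $N$, and $M_k(\Gamma_0(N))$ is the space of (holomorphic) modular forms of weight $k$ for $\Gamma_0(N)$ (with trivial character). *)

theory Defs
  imports "HOL-Complex_Analysis.Complex_Analysis"
begin

definition upper_half_plane :: "complex set" where
  "upper_half_plane = {z. Im z > 0}"

text \<open>
  The factor with index \<open>n\<close> below is \<open>1 - q ^ (n + 1)\<close> with \<open>q = exp (2 * pi * \<i> * z)\<close>.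
  The power \<open>q powr (1 / 24)\<close> would not do for the leading factor, since it takes the principal
  branch in \<open>q\<close> instead of the intended \<open>exp (2 * pi * \<i> * z / 24)\<close>.
\<close>
definition dedekind_eta :: "complex \<Rightarrow> complex" where
  "dedekind_eta z =
     exp (2 * of_real pi * \<i> * z / 24) * (\<Prod>n. 1 - exp (2 * of_real pi * \<i> * z) ^ Suc n)"

definition SL2Z :: "(int ^ 2 ^ 2) set" where
  "SL2Z = {A. det A = 1}"

definition Gamma0 :: "nat \<Rightarrow> (int ^ 2 ^ 2) set" where
  "Gamma0 N = {A \<in> SL2Z. int N dvd A $ 2 $ 1}"

definition automorphy_factor :: "int ^ 2 ^ 2 \<Rightarrow> complex \<Rightarrow> complex" where
  "automorphy_factor A z = of_int (A $ 2 $ 1) * z + of_int (A $ 2 $ 2)"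

definition moebius :: "int ^ 2 ^ 2 \<Rightarrow> complex \<Rightarrow> complex" where
  "moebius A z = (of_int (A $ 1 $ 1) * z + of_int (A $ 1 $ 2)) / automorphy_factor A z"

definition slash :: "int \<Rightarrow> int ^ 2 ^ 2 \<Rightarrow> (complex \<Rightarrow> complex) \<Rightarrow> complex \<Rightarrow> complex" where
  "slash k A f z = automorphy_factor A z powi (- k) * f (moebius A z)"

text \<open>
  Holomorphy at \<open>\<i>\<infinity>\<close>: for some period \<open>h\<close>, the function is a holomorphic function of
  \<open>exp (2 * pi * \<i> * z / h)\<close> on the whole unit disc, the centre included; equivalently, its
  Fourier expansion has no negative exponents. The choice of the period \<open>h\<close> is immaterial.
\<close>
definition holomorphic_at_ii_inf :: "(complex \<Rightarrow> complex) \<Rightarrow> bool" where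
  "holomorphic_at_ii_inf f \<longleftrightarrow>
     (\<exists>h::nat. h > 0 \<and>
       (\<exists>g. g holomorphic_on ball 0 1 \<and>
            (\<forall>z\<in>upper_half_plane. f z = g (exp (2 * of_real pi * \<i> * z / of_nat h)))))"

text \<open>
  Modular forms are functions on the upper half plane; here they are represented by total
  functions, whose values outside the upper half plane are irrelevant. Every cusp is of the form
  \<open>A \<i>\<infinity>\<close> with \<open>A \<in> SL2Z\<close>, so the last condition is holomorphy at all cusps.
\<close>
definition modular_forms ::
    "int \<Rightarrow> (int ^ 2 ^ 2) set \<Rightarrow> (complex \<Rightarrow> complex) set" where
  "modular_forms k G =
     {f. f holomorphic_on upper_half_plane \<and>
         (\<forall>A\<in>G. \<forall>z\<in>upper_half_plane. slash k A f z = f z) \<and>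
         (\<forall>A\<in>SL2Z. holomorphic_at_ii_inf (slash k A f))}"

end

theory Submission
  imports Defs
begin

text \<open>
  With \<open>k = 2 m\<close>, the quotient is \<open>F (2 p z) ^ m\<close> for \<open>F z = \<eta> (2 z) ^ 8 / \<eta> z ^ 4\<close>, which is
  \<open>\<theta>\<^sub>2 ^ 4 / 16\<close>. The group \<open>SL2Z\<close> permutes \<open>\<theta>\<^sub>2 ^ 4\<close>, \<open>\<theta>\<^sub>3 ^ 4\<close>, \<open>\<theta>\<^sub>4 ^ 4\<close>
  up to sign and the automorphy factor of weight 2, and the matrices with even off-diagonal entries
  fix each of them. Conjugating by \<open>z \<mapsto> 2 p z\<close> maps \<open>\<Gamma>\<^sub>0(4 p)\<close> to such matrices,
  and it turns any other element of \<open>SL2Z\<close> into an element of \<open>SL2Z\<close> followed by an upper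
  triangular matrix, so that all cusps are covered by the three expansions at infinity.

  This rests on \<open>\<eta> (- 1 / z) ^ 2 = - \<i> z \<eta> z ^ 2\<close>. The Jacobi products for \<open>\<tau>\<close> and
  \<open>- 1 / \<tau>\<close> have the same zeros and, after multiplication by the exponential of a quadratic
  polynomial, the same quasi-periods, hence are proportional by Liouville's theorem. The derivative
  at \<open>0\<close> and the three half periods give two expressions for the factor of proportionality.
\<close>

section \<open>Infinite products\<close>

text \<open>The q-Pochhammer symbol (x; q) with infinitely many factors. Its index starts at 0, so
  the product in the eta function is \<open>qpoch q q\<close>.\<close>

definition qpoch :: "complex \<Rightarrow> complex \<Rightarrow> complex" where
  "qpoch x q = (\<Prod>n. 1 - x * q ^ n)"

lemma convergent_prod_qpoch:
  fixes x q :: complex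
  assumes "norm q < 1"
  shows "convergent_prod (\<lambda>n. 1 - x * q ^ n)"
  using assms
  by (intro abs_convergent_prod_imp_convergent_prod summable_imp_abs_convergent_prod)
     (simp add: norm_mult norm_power summable_mult summable_geometric)

lemma tendsto_qpoch:
  assumes "norm q < 1"
  shows "(\<lambda>N. \<Prod>n<N. 1 - x * q ^ n) \<longlonglongrightarrow> qpoch x q"
  using convergent_prod_LIMSEQ[OF convergent_prod_qpoch[OF assms, of x]]
  unfolding qpoch_def by (simp only: LIMSEQ_lessThan_iff_atMost)

text \<open>\<open>convergent_prod\<close> asks for a nonzero limit after finitely many factors are
  dropped, so only a vanishing factor can make the product vanish.\<close>

lemma qpoch_eq_0_iff:
  assumes "norm q < 1"
  shows "qpoch x q = 0 \<longleftrightarrow> (\<exists>n. x * q ^ n = 1)"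
proof -
  have "qpoch x q = 0 \<longleftrightarrow> (\<exists>n. 1 - x * q ^ n = 0)"
    unfolding qpoch_def using convergent_prod_qpoch[OF assms, of x]
    by (metis (no_types, lifting) has_prod_eq_0_iff convergent_prod_has_prod rangeE rangeI)
  thus ?thesis by auto
qed

lemma qpoch_rec:
  assumes "norm q < 1"
  shows "qpoch x q = (1 - x) * qpoch (x * q) q"
proof -
  have "(\<lambda>N. \<Prod>n<Suc N. 1 - x * q ^ n) \<longlonglongrightarrow> qpoch x q"
    using tendsto_qpoch[OF assms, of x] by (rule LIMSEQ_Suc)
  moreover have "(\<Prod>n<Suc N. 1 - x * q ^ n) = (1 - x) * (\<Prod>n<N. 1 - (x * q) * q ^ n)" for N
    by (subst prod.lessThan_Suc_shift) (simp add: mult.assoc)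
  moreover have "(\<lambda>N. (1 - x) * (\<Prod>n<N. 1 - (x * q) * q ^ n)) \<longlonglongrightarrow> (1 - x) * qpoch (x * q) q"
    by (intro tendsto_mult tendsto_const tendsto_qpoch assms)
  ultimately show ?thesis
    using LIMSEQ_unique by force
qed

lemma qpoch_square:
  assumes "norm q < 1"
  shows "qpoch (x\<^sup>2) (q\<^sup>2) = qpoch x q * qpoch (- x) q"
proof -
  have "norm (q\<^sup>2) < 1"
    using assms by (simp add: norm_power power_less_one_iff)
  hence "(\<lambda>N. \<Prod>n<N. 1 - x\<^sup>2 * (q\<^sup>2) ^ n) \<longlonglongrightarrow> qpoch (x\<^sup>2) (q\<^sup>2)"
    by (rule tendsto_qpoch)
  moreover have "(\<Prod>n<N. 1 - x\<^sup>2 * (q\<^sup>2) ^ n) = (\<Prod>n<N. 1 - x * q ^ n) * (\<Prod>n<N. 1 - (- x) * q ^ n)" for N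
    unfolding prod.distrib[symmetric]
    by (intro prod.cong) (auto simp: algebra_simps power2_eq_square power_mult_distrib)
  moreover have "(\<lambda>N. (\<Prod>n<N. 1 - x * q ^ n) * (\<Prod>n<N. 1 - (- x) * q ^ n)) \<longlonglongrightarrow> qpoch x q * qpoch (- x) q"
    by (intro tendsto_mult tendsto_qpoch assms)
  ultimately show ?thesis
    using LIMSEQ_unique by force
qed

text \<open>The factors are split by the parity of the index, along the partial products of even
  length.\<close>

lemma qpoch_even_odd:
  assumes "norm q < 1"
  shows "qpoch x q = qpoch x (q\<^sup>2) * qpoch (x * q) (q\<^sup>2)"
proof -
  have q2: "norm (q\<^sup>2) < 1"
    using assms by (simp add: norm_power power_less_one_iff)
  have "(\<lambda>N. \<Prod>n<2 * N. 1 - x * q ^ n) \<longlonglongrightarrow> qpoch x q"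
    using LIMSEQ_subseq_LIMSEQ[OF tendsto_qpoch[OF assms, of x], of "\<lambda>N. 2 * N"]
    by (simp add: strict_mono_def o_def)
  moreover have "(\<Prod>n<2 * N. 1 - x * q ^ n) =
                   (\<Prod>n<N. 1 - x * (q\<^sup>2) ^ n) * (\<Prod>n<N. 1 - (x * q) * (q\<^sup>2) ^ n)" for N
    by (induction N) (auto simp: power_mult[symmetric] mult_ac)
  moreover have "(\<lambda>N. (\<Prod>n<N. 1 - x * (q\<^sup>2) ^ n) * (\<Prod>n<N. 1 - (x * q) * (q\<^sup>2) ^ n))
                   \<longlonglongrightarrow> qpoch x (q\<^sup>2) * qpoch (x * q) (q\<^sup>2)"
    by (intro tendsto_mult tendsto_qpoch q2)
  ultimately show ?thesis
    using LIMSEQ_unique by force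
qed

text \<open>Weierstrass M-test: on a compact set the norms of \<open>u\<close> and \<open>v\<close>
  attain their maxima, which give a geometric majorant. Both arguments vary because eta needs
  \<open>qpoch q q\<close> as a function of \<open>q\<close>.\<close>

lemma uniform_limit_qpoch:
  assumes "compact K" "continuous_on K u" "continuous_on K v" "\<And>z. z \<in> K \<Longrightarrow> norm (v z) < 1"
  shows "uniform_limit K (\<lambda>N z. \<Prod>n<N. 1 - u z * v z ^ n) (\<lambda>z. qpoch (u z) (v z)) sequentially"
proof (cases "K = {}")
  case False
  obtain z1 where z1: "z1 \<in> K" "\<And>z. z \<in> K \<Longrightarrow> norm (u z) \<le> norm (u z1)"
    using continuous_attains_sup[OF assms(1) False continuous_on_norm[OF assms(2)]] by blast
  obtain z2 where z2: "z2 \<in> K" "\<And>z. z \<in> K \<Longrightarrow> norm (v z) \<le> norm (v z2)"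
    using continuous_attains_sup[OF assms(1) False continuous_on_norm[OF assms(3)]] by blast
  have "summable (\<lambda>n. norm (u z1) * norm (v z2) ^ n)"
    using assms(4)[OF z2(1)] by (simp add: summable_mult summable_geometric)
  hence "uniformly_convergent_on K (\<lambda>N z. \<Sum>n<N. norm ((1 - u z * v z ^ n) - 1))"
    by (rule Weierstrass_m_test'[rotated])
       (auto simp: norm_mult norm_power intro!: mult_mono power_mono z1 z2)
  hence "uniformly_convergent_on K (\<lambda>N z. \<Prod>n<N. 1 - u z * v z ^ n)"
    by (intro uniformly_convergent_on_prod' assms continuous_intros)
  then obtain l where l: "uniform_limit K (\<lambda>N z. \<Prod>n<N. 1 - u z * v z ^ n) l sequentially"
    by (auto simp: uniformly_convergent_on_def)
  have "l z = qpoch (u z) (v z)" if "z \<in> K" for z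
    using tendsto_uniform_limitI[OF l that] tendsto_qpoch[OF assms(4)[OF that], of "u z"]
    by (rule LIMSEQ_unique)
  with l show ?thesis
    using uniform_limit_cong' by (metis (mono_tags, lifting))
qed auto

lemma holomorphic_on_qpoch:
  assumes "open S" "u holomorphic_on S" "v holomorphic_on S" "\<And>z. z \<in> S \<Longrightarrow> norm (v z) < 1"
  shows "(\<lambda>z. qpoch (u z) (v z)) holomorphic_on S"
proof (rule holomorphic_uniform_sequence[OF \<open>open S\<close>])
  show "(\<lambda>z. \<Prod>n<N. 1 - u z * v z ^ n) holomorphic_on S" for N
    by (intro holomorphic_intros assms)
  fix x assume "x \<in> S"
  then obtain d where d: "d > 0" "cball x d \<subseteq> S"
    using \<open>open S\<close> open_contains_cball by blast
  have "uniform_limit (cball x d) (\<lambda>N z. \<Prod>n<N. 1 - u z * v z ^ n) (\<lambda>z. qpoch (u z) (v z)) sequentially"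
    using d assms by (intro uniform_limit_qpoch)
      (auto intro: continuous_on_subset holomorphic_on_imp_continuous_on)
  with d show "\<exists>d>0. cball x d \<subseteq> S \<and>
      uniform_limit (cball x d) (\<lambda>N z. \<Prod>n<N. 1 - u z * v z ^ n) (\<lambda>z. qpoch (u z) (v z)) sequentially"
    by blast
qed

text \<open>The factor \<open>\<Prod> (1 - q ^ n)\<close> of the Jacobi triple product is omitted.\<close>
definition theta_prod :: "complex \<Rightarrow> complex \<Rightarrow> complex" where
  "theta_prod x q = qpoch x q * qpoch (q / x) q"

text \<open>Passing from \<open>x\<close> to \<open>q * x\<close> removes the factor
  \<open>1 - x\<close> from one product and adds \<open>1 - 1 / x\<close> to the other; the ratio of
  the two is \<open>- 1 / x\<close>.\<close>

lemma theta_prod_mult: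
  assumes "norm q < 1" "q \<noteq> 0" "x \<noteq> 0"
  shows "theta_prod (q * x) q = - theta_prod x q / x"
proof -
  have "qpoch (q / (q * x)) q = (1 - 1 / x) * qpoch (q / x) q"
    using qpoch_rec[OF assms(1), of "1 / x"] assms by simp
  moreover have "qpoch x q = (1 - x) * qpoch (q * x) q"
    using qpoch_rec[OF assms(1), of x] by (simp add: mult.commute)
  moreover have "A * ((1 - 1 / x) * B) = - ((1 - x) * A * B) / x" for A B
    using assms by (simp add: field_simps)
  ultimately show ?thesis
    by (simp only: theta_prod_def)
qed

lemma qpoch_self_nonzero:
  assumes "norm q < 1"
  shows "qpoch q q \<noteq> 0"
proof -
  have "q * q ^ n \<noteq> 1" for n
  proof
    assume "q * q ^ n = 1"
    hence "norm q ^ Suc n = 1"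
      by (metis norm_one norm_power power_Suc)
    with assms power_less_one_iff[of "norm q" "Suc n"] show False by simp
  qed
  thus ?thesis using qpoch_eq_0_iff[OF assms] by simp
qed

lemma qpoch_self_neg:
  assumes "norm q < 1"
  shows "qpoch (- q) q = qpoch (q\<^sup>2) (q\<^sup>2) / qpoch q q"
  using qpoch_square[OF assms, of q] qpoch_self_nonzero[OF assms] by (simp add: field_simps)

lemma qpoch_self_square:
  assumes "norm q < 1"
  shows "qpoch q (q\<^sup>2) = qpoch q q / qpoch (q\<^sup>2) (q\<^sup>2)"
proof -
  have "norm (q\<^sup>2) < 1"
    using assms by (simp add: norm_power power_less_one_iff)
  thus ?thesis
    using qpoch_even_odd[OF assms, of q] qpoch_self_nonzero[of "q\<^sup>2"]
    by (simp add: field_simps power2_eq_square)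
qed

lemma theta_prod_neg1:
  assumes "norm q < 1"
  shows "theta_prod (-1) q = 2 * (qpoch (- q) q)\<^sup>2"
  using qpoch_rec[OF assms, of "-1"] by (simp add: theta_prod_def power2_eq_square)

lemma theta_prod_sqrt:
  assumes "r \<noteq> 0"
  shows "theta_prod r (r\<^sup>2) = (qpoch r (r\<^sup>2))\<^sup>2"
  using assms by (simp add: theta_prod_def power2_eq_square)

text \<open>Each of the three values is a square, the first up to a factor 2. What remains is
  Euler's identity \<open>qpoch (- q) q * qpoch q (q\<^sup>2) = 1\<close>.\<close>

lemma theta_prod_half_periods:
  assumes "norm r < 1" "r \<noteq> 0"
  shows "theta_prod (-1) (r\<^sup>2) * theta_prod r (r\<^sup>2) * theta_prod (- r) (r\<^sup>2) = 2"
proof -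
  define q where "q = r\<^sup>2"
  have q: "norm q < 1"
    using assms by (simp add: q_def norm_power power_less_one_iff)
  have q2: "norm (q\<^sup>2) < 1"
    using q by (simp add: norm_power power_less_one_iff)
  have "theta_prod (- r) q = (qpoch (- r) q)\<^sup>2"
    using theta_prod_sqrt[of "- r"] assms by (simp add: q_def)
  moreover have "qpoch r q * qpoch (- r) q = qpoch q (q\<^sup>2)"
    using qpoch_square[OF q, of r] by (simp add: q_def)
  moreover have "qpoch (- q) q * qpoch q (q\<^sup>2) = 1"
    using qpoch_self_neg[OF q] qpoch_self_square[OF q] qpoch_self_nonzero[OF q]
      qpoch_self_nonzero[OF q2] by simp
  ultimately show ?thesis
    using theta_prod_neg1[OF q] theta_prod_sqrt[OF assms(2)]
    by (simp flip: q_def power_mult_distrib add: mult.assoc)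
qed

section \<open>Elliptic functions and theta products\<close>

text \<open>All zeros of \<open>B\<close> are simple and are zeros of \<open>A\<close>, so the
  singularities of \<open>A / B\<close> are removable.\<close>

lemma entire_quotient:
  fixes A B :: "complex \<Rightarrow> complex"
  assumes A: "A holomorphic_on UNIV" and B: "B holomorphic_on UNIV"
    and zeros: "\<And>z. B z = 0 \<Longrightarrow> A z = 0 \<and> deriv B z \<noteq> 0"
  obtains h where "h holomorphic_on UNIV" "\<And>z. A z = h z * B z"
proof
  \<comment> \<open>At a zero of \<open>B\<close>, the value is the limit given by l'Hopital's
    rule.\<close>
  define h where "h = (\<lambda>z. if B z = 0 then deriv A z / deriv B z else A z / B z)"
  show "A z = h z * B z" for z
    using zeros[of z] by (auto simp: h_def)
  have "\<exists>r>0. h holomorphic_on ball z r" for z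
  proof (cases "B z = 0")
    case False
    have "open {z. B z \<noteq> 0}"
      using B by (auto simp: holomorphic_on_imp_continuous_on intro!: open_Collect_neq continuous_intros)
    then obtain r where r: "r > 0" "ball z r \<subseteq> {z. B z \<noteq> 0}"
      using False by (auto simp: open_contains_ball)
    have "(\<lambda>z. A z / B z) holomorphic_on ball z r"
      using r by (intro holomorphic_on_divide holomorphic_on_subset[OF A] holomorphic_on_subset[OF B]) auto
    hence "h holomorphic_on ball z r"
      by (rule holomorphic_transform) (use r in \<open>auto simp: h_def\<close>)
    with r show ?thesis by blast
  next
    case True
    obtain r where r: "r > 0" "inj_on B (ball z r)"
      using has_complex_derivative_locally_injective[OF B, of z] zeros[OF True] by auto
    have nz: "B w \<noteq> 0" if "w \<in> ball z r - {z}" for w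
      using inj_onD[OF r(2), of w z] that True r(1) by auto
    have "((\<lambda>w. A w / B w) \<longlongrightarrow> h z) (at z)"
      using True zeros[OF True] holomorphic_derivI[OF A, of z] holomorphic_derivI[OF B, of z]
      by (intro lhopital_complex_simple[of A "deriv A z" z B "deriv B z"]) (auto simp: h_def)
    moreover have "eventually (\<lambda>w. A w / B w = h w) (at z)"
      using eventually_at_in_open[of "ball z r" z] r(1) nz
      by (auto simp: h_def elim!: eventually_mono)
    ultimately have "(h \<longlongrightarrow> h z) (at z)"
      by (rule Lim_transform_eventually)
    moreover have "(\<lambda>w. A w / B w) holomorphic_on ball z r - {z}"
      using nz by (intro holomorphic_on_divide holomorphic_on_subset[OF A] holomorphic_on_subset[OF B]) auto
    hence "h holomorphic_on ball z r - {z}"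
      by (rule holomorphic_transform) (use nz in \<open>auto simp: h_def\<close>)
    ultimately have "h holomorphic_on ball z r"
      using no_isolated_singularity'[of "{z}" h "ball z r"] Lim_at_imp_Lim_at_within by blast
    with r show ?thesis by blast
  qed
  thus "h holomorphic_on UNIV"
    unfolding analytic_on_open[OF open_UNIV, symmetric] by (simp add: analytic_on_def)
qed

text \<open>All values are taken on the compact period parallelogram \<open>K\<close>, so
  Liouville's theorem applies.\<close>

lemma entire_doubly_periodic_constant:
  fixes h :: "complex \<Rightarrow> complex"
  assumes "h holomorphic_on UNIV" "\<And>z. h (z + 1) = h z" "\<And>z. h (z + \<tau>) = h z" "Im \<tau> > 0"
  obtains c where "\<And>z. h z = c"
proof -
  interpret one: periodic_fun_simple h 1
    by standard (rule assms)
  interpret tau: periodic_fun_simple h \<tau>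
    by standard (rule assms)
  define K where "K = (\<lambda>(x, y). of_real x + of_real y * \<tau>) ` ({0..1} \<times> {0..1})"
  have "compact K"
    unfolding K_def case_prod_unfold
    by (intro compact_continuous_image compact_Times compact_Icc continuous_intros)
  hence "bounded (h ` K)"
    using assms(1) by (intro compact_imp_bounded compact_continuous_image)
      (auto intro: continuous_on_subset holomorphic_on_imp_continuous_on)
  moreover have "range h \<subseteq> h ` K"
  proof safe
    fix z
    define y where "y = Im z / Im \<tau>"
    define x where "x = Re z - y * Re \<tau>"
    have z: "z = of_real x + of_real y * \<tau>"
      using assms(4) by (simp add: complex_eq_iff x_def y_def)
    have "h z = h (of_real (frac x) + of_real (frac y) * \<tau> + of_int \<lfloor>y\<rfloor> * \<tau> + of_int \<lfloor>x\<rfloor> * 1)"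
      by (simp add: z frac_def algebra_simps)
    also have "\<dots> = h (of_real (frac x) + of_real (frac y) * \<tau>)"
      by (simp only: one.plus_of_int tau.plus_of_int)
    also have "\<dots> \<in> h ` K"
      unfolding K_def
      by (intro imageI image_eqI[where x = "(frac x, frac y)"]) (auto simp: frac_ge_0 less_imp_le[OF frac_lt_1])
    finally show "h z \<in> h ` K" .
  qed
  ultimately have "bounded (range h)"
    by (rule bounded_subset)
  with Liouville_theorem[OF assms(1)] that show ?thesis
    by (auto simp: constant_on_def)
qed

text \<open>The common multipliers cancel in the quotient of \<open>A\<close> and \<open>B\<close>,
  which is thus entire and doubly periodic.\<close>

lemma quasiperiodic_proportional:
  fixes A B m :: "complex \<Rightarrow> complex"
  assumes A: "A holomorphic_on UNIV" and B: "B holomorphic_on UNIV"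
    and zeros: "\<And>z. B z = 0 \<Longrightarrow> A z = 0 \<and> deriv B z \<noteq> 0"
    and one: "\<And>z. A (z + 1) = A z" "\<And>z. B (z + 1) = B z"
    and tau: "\<And>z. A (z + \<tau>) = m z * A z" "\<And>z. B (z + \<tau>) = m z * B z" "\<And>z. m z \<noteq> 0"
    and "Im \<tau> > 0"
  obtains c where "\<And>z. A z = c * B z"
proof -
  obtain h where h: "h holomorphic_on UNIV" "\<And>z. A z = h z * B z"
    using entire_quotient[OF A B zeros] by blast
  \<comment> \<open>This cancels \<open>B\<close> even at its zeros: there, differentiating
    \<open>D z * B z = 0\<close> leaves \<open>D z * deriv B z = 0\<close>, and the zero of
    \<open>B\<close> is simple.\<close>
  have zero: "D z = 0" if D: "D holomorphic_on UNIV" and DB: "\<And>z. D z * B z = 0" for D z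
  proof (cases "B z = 0")
    case True
    have "((\<lambda>z. D z * B z) has_field_derivative deriv D z * B z + deriv B z * D z) (at z)"
      by (intro DERIV_mult holomorphic_derivI[OF D] holomorphic_derivI[OF B]) auto
    hence "deriv D z * B z + deriv B z * D z = 0"
      using DB by (simp add: DERIV_unique[of "\<lambda>_. 0" _ z])
    with True zeros[of z] show ?thesis by simp
  qed (use DB[of z] in auto)
  have shift: "(\<lambda>z. h (z + w)) holomorphic_on UNIV" for w
  proof -
    have "h \<circ> (\<lambda>z. z + w) holomorphic_on UNIV"
      by (intro holomorphic_on_compose holomorphic_intros holomorphic_on_subset[OF h(1)]) auto
    thus ?thesis by (simp add: o_def)
  qed
  have "h (z + 1) - h z = 0" for z
  proof (rule zero[of "\<lambda>z. h (z + 1) - h z"])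
    fix z
    have "h (z + 1) * B z = h z * B z"
      using h(2)[of "z + 1"] h(2)[of z] one[of z] by metis
    thus "(h (z + 1) - h z) * B z = 0"
      by (simp add: left_diff_distrib)
  qed (intro holomorphic_intros h(1) shift)
  moreover have "h (z + \<tau>) - h z = 0" for z
  proof (rule zero[of "\<lambda>z. h (z + \<tau>) - h z"])
    fix z
    have "m z * (h (z + \<tau>) * B z) = m z * (h z * B z)"
      using h(2)[of "z + \<tau>"] h(2)[of z] tau(1,2)[of z] by (metis mult.left_commute)
    thus "(h (z + \<tau>) - h z) * B z = 0"
      using tau(3)[of z] by (simp add: left_diff_distrib)
  qed (intro holomorphic_intros h(1) shift)
  ultimately obtain c where "\<And>z. h z = c"
    using entire_doubly_periodic_constant[OF h(1) _ _ \<open>Im \<tau> > 0\<close>] by auto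
  thus ?thesis
    using h(2) by (intro that[of c]) simp
qed

section \<open>The exponential with period 1\<close>

definition e2pi :: "complex \<Rightarrow> complex" where
  "e2pi z = exp (2 * of_real pi * \<i> * z)"

lemma e2pi_add: "e2pi (a + b) = e2pi a * e2pi b"
  by (simp add: e2pi_def ring_distribs exp_add)

lemma e2pi_minus: "e2pi (- a) = inverse (e2pi a)"
  by (simp add: e2pi_def exp_minus)

lemma e2pi_diff: "e2pi (a - b) = e2pi a / e2pi b"
  by (simp add: e2pi_def ring_distribs exp_diff)

lemma e2pi_nonzero [simp]: "e2pi z \<noteq> 0"
  by (simp add: e2pi_def)

lemma e2pi_0 [simp]: "e2pi 0 = 1"
  by (simp add: e2pi_def)

lemma e2pi_power: "e2pi z ^ n = e2pi (of_nat n * z)"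
  by (simp add: e2pi_def exp_of_nat_mult[symmetric] mult_ac)

lemma e2pi_half [simp]: "e2pi (1 / 2) = -1"
  by (simp add: e2pi_def)

lemma e2pi_quarter [simp]: "e2pi (1 / 4) = \<i>"
  using cis_conv_exp[of "pi / 2"] by (simp add: e2pi_def mult_ac)

lemma norm_e2pi: "norm (e2pi z) = exp (- (2 * pi * Im z))"
  by (simp add: e2pi_def)

lemma norm_e2pi_less_1 [simp]: "norm (e2pi z) < 1 \<longleftrightarrow> Im z > 0"
  by (simp add: norm_e2pi zero_less_mult_iff)

lemma e2pi_eq_1_iff: "e2pi z = 1 \<longleftrightarrow> (\<exists>n::int. z = of_int n)"
proof -
  have "e2pi z = 1 \<longleftrightarrow> Im z = 0 \<and> (\<exists>n::int. 2 * pi * Re z = of_int (2 * n) * pi)"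
    by (simp add: e2pi_def exp_eq_1)
  also have "\<dots> \<longleftrightarrow> (\<exists>n::int. z = of_int n)"
    by (auto simp: complex_eq_iff mult_ac)
  finally show ?thesis .
qed

lemma e2pi_of_int [simp]: "e2pi (of_int n) = 1"
  using e2pi_eq_1_iff by blast

lemma e2pi_1 [simp]: "e2pi 1 = 1"
  using e2pi_of_int[of 1] by simp

lemma holomorphic_on_e2pi [holomorphic_intros]:
  "f holomorphic_on S \<Longrightarrow> (\<lambda>z. e2pi (f z)) holomorphic_on S"
  unfolding e2pi_def by (intro holomorphic_intros)

lemma has_field_derivative_e2pi:
  "(e2pi has_field_derivative 2 * of_real pi * \<i> * e2pi z) (at z)"
  unfolding e2pi_def by (auto intro!: derivative_eq_intros)

text \<open>Up to an exponential factor and a factor independent of \<open>z\<close>, this is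
  Jacobi's odd theta function.\<close>

definition theta :: "complex \<Rightarrow> complex \<Rightarrow> complex" where
  "theta \<tau> z = theta_prod (e2pi z) (e2pi \<tau>)"

lemma theta_plus_1 [simp]: "theta \<tau> (z + 1) = theta \<tau> z"
  by (simp add: theta_def e2pi_add)

lemma theta_plus_tau:
  assumes "Im \<tau> > 0"
  shows "theta \<tau> (z + \<tau>) = - theta \<tau> z / e2pi z"
  using theta_prod_mult[of "e2pi \<tau>" "e2pi z"] assms
  by (simp add: theta_def e2pi_add mult.commute)

text \<open>The first product vanishes at the lattice points with a coefficient of
  \<open>\<tau>\<close> that is at most 0, the second at those with a positive one.\<close>

lemma theta_eq_0_iff:
  assumes "Im \<tau> > 0"
  shows "theta \<tau> z = 0 \<longleftrightarrow> (\<exists>m n. z = of_int m + of_int n * \<tau>)"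
proof -
  have "theta \<tau> z = 0 \<longleftrightarrow> (\<exists>n. e2pi (z + of_nat n * \<tau>) = 1) \<or> (\<exists>n. e2pi (\<tau> - z + of_nat n * \<tau>) = 1)"
    using assms by (simp add: theta_def theta_prod_def qpoch_eq_0_iff e2pi_power e2pi_add e2pi_diff)
  also have "\<dots> \<longleftrightarrow> (\<exists>n m. z + of_nat n * \<tau> = of_int m) \<or> (\<exists>n m. \<tau> - z + of_nat n * \<tau> = of_int m)"
    by (simp add: e2pi_eq_1_iff)
  also have "\<dots> \<longleftrightarrow> (\<exists>m n. z = of_int m + of_int n * \<tau>)"
  proof safe
    fix n :: nat and m :: int
    assume "z + of_nat n * \<tau> = of_int m"
    thus "\<exists>m n. z = of_int m + of_int n * \<tau>"
      by (intro exI[of _ m] exI[of _ "- int n"]) (simp add: algebra_simps)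
  next
    fix n :: nat and m :: int
    assume "\<tau> - z + of_nat n * \<tau> = of_int m"
    thus "\<exists>m n. z = of_int m + of_int n * \<tau>"
      by (intro exI[of _ "- m"] exI[of _ "int n + 1"]) (simp add: algebra_simps)
  next
    fix m n :: int
    assume *: "\<nexists>k l. \<tau> - (of_int m + of_int n * \<tau>) + of_nat k * \<tau> = of_int l"
    \<comment> \<open>A positive \<open>n\<close> would give a zero of the second product, which
      \<open>*\<close> excludes.\<close>
    have "n \<le> 0"
    proof (rule ccontr)
      assume "\<not> n \<le> 0"
      hence "\<tau> - (of_int m + of_int n * \<tau>) + of_nat (nat (n - 1)) * \<tau> = of_int (- m)"
        by (simp add: algebra_simps)
      with * show False by blast
    qed
    thus "\<exists>k l. of_int m + of_int n * \<tau> + of_nat k * \<tau> = of_int l"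
      by (intro exI[of _ "nat (- n)"] exI[of _ m]) (simp add: algebra_simps)
  qed
  finally show ?thesis .
qed

lemma holomorphic_on_theta:
  assumes "Im \<tau> > 0"
  shows "theta \<tau> holomorphic_on S"
proof -
  have "theta \<tau> holomorphic_on UNIV"
    unfolding theta_def[abs_def] theta_prod_def using assms
    by (intro holomorphic_intros holomorphic_on_qpoch) auto
  thus ?thesis by (rule holomorphic_on_subset) simp
qed

text \<open>The factor \<open>1 - e2pi z\<close> vanishes at 0, so only its derivative, times the
  remaining product at 0, survives in the product rule.\<close>

lemma deriv_theta_0:
  assumes "Im \<tau> > 0"
  shows "deriv (theta \<tau>) 0 = - 2 * of_real pi * \<i> * (qpoch (e2pi \<tau>) (e2pi \<tau>))\<^sup>2"
proof -
  define q where "q = e2pi \<tau>"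
  have q: "norm q < 1" using assms by (simp add: q_def)
  define v where "v = (\<lambda>z. qpoch (e2pi z * q) q * qpoch (q / e2pi z) q)"
  have "v holomorphic_on UNIV"
    unfolding v_def using q by (intro holomorphic_intros holomorphic_on_qpoch) auto
  hence "(v has_field_derivative deriv v 0) (at 0)"
    by (rule holomorphic_derivI) auto
  hence "((\<lambda>z. (1 - e2pi z) * v z) has_field_derivative
           (0 - 2 * of_real pi * \<i> * e2pi 0) * v 0 + deriv v 0 * (1 - e2pi 0)) (at 0)"
    by (intro DERIV_mult DERIV_diff DERIV_const has_field_derivative_e2pi)
  moreover have "(\<lambda>z. (1 - e2pi z) * v z) = theta \<tau>"
    unfolding v_def theta_def[abs_def] theta_prod_def q_def[symmetric]
    by (subst (2) qpoch_rec[OF q]) (simp add: mult.assoc)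
  ultimately show ?thesis
    by (auto intro!: DERIV_imp_deriv simp: v_def power2_eq_square q_def)
qed

text \<open>Differentiating the quasi-periodicity at a zero carries the nonvanishing from 0 to all
  multiples of \<open>\<tau>\<close>; period 1 covers the other lattice points.\<close>

lemma deriv_theta_nonzero:
  assumes tau: "Im \<tau> > 0" and "theta \<tau> z = 0"
  shows "deriv (theta \<tau>) z \<noteq> 0"
proof -
  obtain m n where mn: "z = of_int m + of_int n * \<tau>"
    using assms theta_eq_0_iff by blast
  have D: "(theta \<tau> has_field_derivative deriv (theta \<tau>) w) (at w)" for w
    by (rule holomorphic_derivI[OF holomorphic_on_theta[OF tau, of UNIV]]) auto
  interpret periodic_fun_simple "theta \<tau>" 1
    by standard simp
  have step: "deriv (theta \<tau>) (w + \<tau>) = - deriv (theta \<tau>) w / e2pi w" if w: "theta \<tau> w = 0" for w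
  proof -
    have "((\<lambda>w. - theta \<tau> w / e2pi w) has_field_derivative
        (- deriv (theta \<tau>) w * e2pi w - - theta \<tau> w * (2 * of_real pi * \<i> * e2pi w)) / (e2pi w * e2pi w)) (at w)"
      by (intro DERIV_divide DERIV_minus D has_field_derivative_e2pi) simp
    moreover have "(\<lambda>w. - theta \<tau> w / e2pi w) = (\<lambda>w. theta \<tau> (w + \<tau>))"
      using theta_plus_tau[OF tau] by simp
    moreover have "((\<lambda>w. theta \<tau> (w + \<tau>)) has_field_derivative deriv (theta \<tau>) (w + \<tau>)) (at w)"
      using D[of "w + \<tau>"] by (simp add: DERIV_shift)
    ultimately show ?thesis
      using w by (auto dest: DERIV_unique)
  qed
  have zero: "theta \<tau> (of_int k * \<tau>) = 0" for k
    unfolding theta_eq_0_iff[OF tau] by (intro exI[of _ 0] exI[of _ k]) simp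
  have "deriv (theta \<tau>) (of_int n * \<tau>) \<noteq> 0"
  proof (induction n rule: int_induct[where k = 0])
    case base
    show ?case
      using deriv_theta_0[OF tau] qpoch_self_nonzero tau by simp
  next
    case (step1 i)
    thus ?case
      using step[OF zero[of i]] by (simp add: algebra_simps)
  next
    case (step2 i)
    thus ?case
      using step[OF zero[of "i - 1"]] by (simp add: algebra_simps)
  qed
  moreover have "deriv (theta \<tau>) z = deriv (theta \<tau>) (of_int n * \<tau>)"
  proof -
    have "(\<lambda>w. theta \<tau> (w + of_int m)) = theta \<tau>"
      using plus_of_int[of _ m] by simp
    moreover have "((\<lambda>w. theta \<tau> (w + of_int m)) has_field_derivative deriv (theta \<tau>) z) (at (of_int n * \<tau>))"
      using D[of z] unfolding mn by (subst DERIV_shift[symmetric]) (simp add: add.commute)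
    ultimately show ?thesis
      using D DERIV_unique by metis
  qed
  ultimately show ?thesis by simp
qed

section \<open>Inversion of the eta function\<close>

lemma Im_minus_inverse_pos:
  assumes "Im \<tau> > 0"
  shows "Im (- 1 / \<tau>) > 0"
proof -
  have "\<tau> \<noteq> 0" using assms by auto
  hence "(Re \<tau>)\<^sup>2 + (Im \<tau>)\<^sup>2 > 0"
    using assms by (simp add: add_nonneg_pos)
  thus ?thesis using assms by (simp add: Im_divide)
qed

text \<open>Division by \<open>\<tau>\<close> maps the lattice of \<open>\<tau>\<close> onto that of
  \<open>- 1 / \<tau>\<close>, so both sides have the same zeros.\<close>

lemma theta_inversion:
  assumes tau: "Im \<tau> > 0"
  obtains c where "\<And>z. e2pi ((z - (z\<^sup>2 + z) / \<tau>) / 2) * theta (- 1 / \<tau>) (z / \<tau>) = c * theta \<tau> z"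
proof -
  define \<tau>' where "\<tau>' = - 1 / \<tau>"
  have tau': "Im \<tau>' > 0"
    using Im_minus_inverse_pos[OF tau] by (simp add: \<tau>'_def)
  have nz: "\<tau> \<noteq> 0" using tau by auto
  \<comment> \<open>This polynomial is chosen to give \<open>A\<close> period 1 and the multiplier
    \<open>- 1 / e2pi z\<close> under \<open>\<tau>\<close>, as for
    \<open>theta \<tau>\<close>.\<close>
  define Q where "Q = (\<lambda>z. (z - (z\<^sup>2 + z) / \<tau>) / 2)"
  define A where "A = (\<lambda>z. e2pi (Q z) * theta \<tau>' (z / \<tau>))"
  have "theta \<tau>' \<circ> (\<lambda>z. z / \<tau>) holomorphic_on UNIV"
    using nz by (intro holomorphic_on_compose holomorphic_intros holomorphic_on_theta tau') auto
  hence A: "A holomorphic_on UNIV"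
    unfolding A_def Q_def o_def using nz by (intro holomorphic_intros) auto
  have one: "A (z + 1) = A z" for z
  proof -
    have "(z + 1) / \<tau> + \<tau>' = z / \<tau>"
      by (simp add: \<tau>'_def add_divide_distrib)
    hence "theta \<tau>' ((z + 1) / \<tau>) = e2pi (1 / 2 + (z + 1) / \<tau>) * theta \<tau>' (z / \<tau>)"
      using theta_plus_tau[OF tau', of "(z + 1) / \<tau>"] by (simp add: e2pi_add)
    moreover have "Q (z + 1) + (1 / 2 + (z + 1) / \<tau>) = Q z + 1"
      using nz by (simp add: Q_def field_simps power2_eq_square)
    hence "e2pi (Q (z + 1)) * e2pi (1 / 2 + (z + 1) / \<tau>) = e2pi (Q z)"
      by (metis e2pi_add e2pi_1 mult.right_neutral)
    ultimately show ?thesis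
      by (simp add: A_def flip: mult.assoc)
  qed
  have shift: "A (z + \<tau>) = (- 1 / e2pi z) * A z" for z
  proof -
    have "(z + \<tau>) / \<tau> = z / \<tau> + 1"
      using nz by (simp add: field_simps)
    moreover have "Q (z + \<tau>) = Q z - z - 1 / 2"
      using nz by (simp add: Q_def field_simps power2_eq_square)
    ultimately show ?thesis
      by (simp add: A_def e2pi_diff)
  qed
  have "A z = 0 \<and> deriv (theta \<tau>) z \<noteq> 0" if z: "theta \<tau> z = 0" for z
  proof
    obtain m n where "z = of_int m + of_int n * \<tau>"
      using z theta_eq_0_iff[OF tau] by blast
    hence "z / \<tau> = of_int n + of_int (- m) * \<tau>'"
      using nz by (simp add: \<tau>'_def field_simps)
    thus "A z = 0"
      unfolding A_def mult_eq_0_iff theta_eq_0_iff[OF tau'] by blast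
  qed (rule deriv_theta_nonzero[OF tau z])
  moreover have "theta \<tau> (z + \<tau>) = (- 1 / e2pi z) * theta \<tau> z" for z
    using theta_plus_tau[OF tau] by simp
  ultimately obtain c where "\<And>z. A z = c * theta \<tau> z"
    using quasiperiodic_proportional[OF A holomorphic_on_theta[OF tau, of UNIV],
        where m = "\<lambda>z. - 1 / e2pi z" and \<tau> = \<tau>] one shift tau by auto
  thus ?thesis
    by (intro that[of c]) (simp add: A_def Q_def \<tau>'_def)
qed

text \<open>With \<open>r = e2pi (\<tau> / 2)\<close>, the half periods correspond to the arguments
  \<open>-1\<close>, \<open>r\<close> and \<open>- r\<close> of \<open>theta_prod\<close>.\<close>

lemma theta_half_periods:
  assumes "Im \<tau> > 0"
  shows "theta \<tau> (1 / 2) * theta \<tau> (\<tau> / 2) * theta \<tau> ((1 + \<tau>) / 2) = 2"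
proof -
  define r where "r = e2pi (\<tau> / 2)"
  have r: "norm r < 1" "r \<noteq> 0"
    using assms by (auto simp: r_def)
  have "r\<^sup>2 = e2pi \<tau>"
    by (simp add: r_def e2pi_power)
  moreover have "e2pi ((1 + \<tau>) / 2) = - r"
    by (simp add: r_def add_divide_distrib e2pi_add)
  ultimately show ?thesis
    using theta_prod_half_periods[OF r] by (simp add: theta_def r_def)
qed

text \<open>The factor \<open>c\<close> of the inversion formula is found twice: from the derivatives at \<open>0\<close>, and, up to
  a cube root of unity, from the product of the values at the three half periods.\<close>
lemma qpoch_inversion_cubed:
  fixes \<tau> :: complex
  defines "\<phi> \<equiv> \<lambda>t. qpoch (e2pi t) (e2pi t)"
  assumes tau: "Im \<tau> > 0"
  shows "(\<phi> (- 1 / \<tau>) ^ 2 / (\<tau> * \<phi> \<tau> ^ 2)) ^ 3 = \<i> * e2pi ((\<tau> + 1 / \<tau>) / 4)"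
proof -
  define \<tau>' where "\<tau>' = - 1 / \<tau>"
  have tau': "Im \<tau>' > 0"
    using Im_minus_inverse_pos[OF tau] by (simp add: \<tau>'_def)
  have nz: "\<tau> \<noteq> 0" using tau by auto
  define Q where "Q = (\<lambda>z. (z - (z\<^sup>2 + z) / \<tau>) / 2)"
  obtain c where c: "\<And>z. e2pi (Q z) * theta \<tau>' (z / \<tau>) = c * theta \<tau> z"
    using theta_inversion[OF tau] unfolding Q_def \<tau>'_def by metis
  have theta0: "theta t 0 = 0" if "Im t > 0" for t
    unfolding theta_eq_0_iff[OF that] by (rule exI[of _ 0])+ simp
  have theta'0: "(theta t has_field_derivative (- 2 * of_real pi * \<i> * (\<phi> t)\<^sup>2)) (at 0)" if "Im t > 0" for t
    using holomorphic_derivI[OF holomorphic_on_theta[OF that, of UNIV], of 0] deriv_theta_0[OF that]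
    by (simp add: \<phi>_def)

  have "(\<lambda>z. e2pi (Q z)) holomorphic_on UNIV"
    unfolding Q_def using nz by (intro holomorphic_intros) auto
  hence "((\<lambda>z. e2pi (Q z)) has_field_derivative deriv (\<lambda>z. e2pi (Q z)) 0) (at 0)"
    by (rule holomorphic_derivI) auto
  moreover have "((\<lambda>z. theta \<tau>' (z / \<tau>)) has_field_derivative (- 2 * of_real pi * \<i> * (\<phi> \<tau>')\<^sup>2) * (1 / \<tau>)) (at 0)"
    by (rule DERIV_chain2[of "theta \<tau>'"])
       (use theta'0[OF tau'] in simp, rule DERIV_cdivide, rule DERIV_ident)
  ultimately have "((\<lambda>z. e2pi (Q z) * theta \<tau>' (z / \<tau>)) has_field_derivative
      deriv (\<lambda>z. e2pi (Q z)) 0 * theta \<tau>' (0 / \<tau>) +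
      (- 2 * of_real pi * \<i> * (\<phi> \<tau>')\<^sup>2) * (1 / \<tau>) * e2pi (Q 0)) (at 0)"
    by (rule DERIV_mult)
  moreover have "((\<lambda>z. c * theta \<tau> z) has_field_derivative c * (- 2 * of_real pi * \<i> * (\<phi> \<tau>)\<^sup>2)) (at 0)"
    by (intro DERIV_cmult theta'0 tau)
  \<comment> \<open>The derivative of the exponential factor drops out, since theta vanishes at
    0.\<close>
  ultimately have "(- 2 * of_real pi * \<i> * (\<phi> \<tau>')\<^sup>2) * (1 / \<tau>) = c * (- 2 * of_real pi * \<i> * (\<phi> \<tau>)\<^sup>2)"
    using DERIV_unique unfolding c by (fastforce simp: theta0[OF tau'] Q_def)
  moreover have "\<phi> \<tau> \<noteq> 0"
    using qpoch_self_nonzero tau by (simp add: \<phi>_def)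
  ultimately have c_eq: "c = \<phi> \<tau>' ^ 2 / (\<tau> * \<phi> \<tau> ^ 2)"
    using nz by (simp add: field_simps)

  \<comment> \<open>Division by \<open>\<tau>\<close> permutes the half periods modulo the new
    lattice; this shift by \<open>\<tau>'\<close> brings them back to the standard
    representatives.\<close>
  have neg: "theta \<tau>' u = - e2pi u * theta \<tau>' (u + \<tau>')" for u
    using theta_plus_tau[OF tau', of u] by (simp add: field_simps)
  have t1: "theta \<tau>' (1 / 2 / \<tau>) = - e2pi (- \<tau>' / 2) * theta \<tau>' (\<tau>' / 2)"
  proof -
    have "1 / 2 / \<tau> = - \<tau>' / 2" "- \<tau>' / 2 + \<tau>' = \<tau>' / 2"
      by (simp_all add: \<tau>'_def)
    thus ?thesis using neg[of "- \<tau>' / 2"] by simp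
  qed
  have t2: "theta \<tau>' (\<tau> / 2 / \<tau>) = theta \<tau>' (1 / 2)"
    using nz by simp
  have "(1 + \<tau>) / 2 / \<tau> = 1 / 2 - \<tau>' / 2"
    using nz by (simp add: \<tau>'_def field_simps)
  moreover have "1 / 2 - \<tau>' / 2 + \<tau>' = (1 + \<tau>') / 2"
    by (simp add: field_simps)
  moreover have "e2pi (1 / 2 - \<tau>' / 2) = - e2pi (- \<tau>' / 2)"
    using e2pi_add[of "1 / 2" "- \<tau>' / 2"] by simp
  ultimately have t3: "theta \<tau>' ((1 + \<tau>) / 2 / \<tau>) = e2pi (- \<tau>' / 2) * theta \<tau>' ((1 + \<tau>') / 2)"
    using neg[of "1 / 2 - \<tau>' / 2"] by (simp only: minus_minus)
  have "c ^ 3 * (theta \<tau> (1 / 2) * theta \<tau> (\<tau> / 2) * theta \<tau> ((1 + \<tau>) / 2)) =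
      (c * theta \<tau> (1 / 2)) * (c * theta \<tau> (\<tau> / 2)) * (c * theta \<tau> ((1 + \<tau>) / 2))"
    by (simp add: power3_eq_cube)
  also have "\<dots> = (- e2pi (- \<tau>' / 2) * e2pi (- \<tau>' / 2) * (e2pi (Q (1 / 2)) * e2pi (Q (\<tau> / 2)) * e2pi (Q ((1 + \<tau>) / 2)))) *
      (theta \<tau>' (1 / 2) * theta \<tau>' (\<tau>' / 2) * theta \<tau>' ((1 + \<tau>') / 2))"
  proof -
    have "(x * (- e * a)) * (y * b) * (z * (e * d)) = (- e * e * (x * y * z)) * (b * a * d)"
      for a b d e x y z :: complex
      by (simp add: mult_ac)
    thus ?thesis
      unfolding c[symmetric] t1 t2 t3 .
  qed
  \<comment> \<open>The products over the half periods equal 2 for both \<open>\<tau>\<close> and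
    \<open>\<tau>'\<close>, so they cancel.\<close>
  finally have "c ^ 3 = - e2pi (- \<tau>' / 2 + - \<tau>' / 2 + (Q (1 / 2) + Q (\<tau> / 2) + Q ((1 + \<tau>) / 2)))"
    unfolding theta_half_periods[OF tau] theta_half_periods[OF tau'] mult_cancel_right
    by (simp only: e2pi_add mult_minus_left numeral_neq_zero simp_thms)
  also have "- \<tau>' / 2 + - \<tau>' / 2 + (Q (1 / 2) + Q (\<tau> / 2) + Q ((1 + \<tau>) / 2)) =
      1 / 4 + (\<tau> + 1 / \<tau>) / 4 - 1 / 2"
    using nz by (simp add: Q_def \<tau>'_def field_simps power2_eq_square)
  finally show ?thesis
    by (simp add: c_eq \<tau>'_def e2pi_add e2pi_diff)
qed

section \<open>The eta function and its inversion\<close>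

lemma dedekind_eta_altdef: "dedekind_eta z = e2pi (z / 24) * qpoch (e2pi z) (e2pi z)"
  by (simp add: dedekind_eta_def qpoch_def e2pi_def)

lemma dedekind_eta_nonzero: "Im z > 0 \<Longrightarrow> dedekind_eta z \<noteq> 0"
  by (simp add: dedekind_eta_altdef qpoch_self_nonzero)

lemma dedekind_eta_plus_1: "dedekind_eta (z + 1) = e2pi (1 / 24) * dedekind_eta z"
  by (simp add: dedekind_eta_altdef e2pi_add add_divide_distrib)

lemma holomorphic_on_dedekind_eta:
  assumes "open S" "f holomorphic_on S" "\<And>z. z \<in> S \<Longrightarrow> Im (f z) > 0"
  shows "(\<lambda>z. dedekind_eta (f z)) holomorphic_on S"
  unfolding dedekind_eta_altdef using assms
  by (intro holomorphic_intros holomorphic_on_qpoch) auto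

lemma open_upper_half_plane: "open upper_half_plane"
  unfolding upper_half_plane_def by (rule open_halfspace_Im_gt)

lemma connected_upper_half_plane: "connected upper_half_plane"
  unfolding upper_half_plane_def by (intro convex_connected convex_halfspace_Im_gt)

text \<open>The quotient \<open>R\<close> is continuous and takes values among the cube roots of
  \<open>\<i>\<close>. On the connected half plane it is constant, and the fixed point
  \<open>\<i>\<close> of the inversion selects the root.\<close>

lemma dedekind_eta_inversion_squared:
  assumes "Im \<tau> > 0"
  shows "dedekind_eta (- 1 / \<tau>) ^ 2 = - \<i> * \<tau> * dedekind_eta \<tau> ^ 2"
proof -
  define R where "R = (\<lambda>t. dedekind_eta (- 1 / t) ^ 2 / (t * dedekind_eta t ^ 2))"
  have R_cubed: "R t ^ 3 = \<i>" if t: "t \<in> upper_half_plane" for t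
  proof -
    have Im_t: "Im t > 0" using t by (simp add: upper_half_plane_def)
    define \<phi> where "\<phi> = (\<lambda>t. qpoch (e2pi t) (e2pi t))"
    \<comment> \<open>The leading exponentials of eta contribute a factor whose cube cancels the
      exponential in \<open>qpoch_inversion_cubed\<close>.\<close>
    have "- 1 / t / 24 * 2 - t / 24 * 2 = - ((t + 1 / t) / 12)"
      using Im_t by (auto simp: field_simps)
    hence e: "e2pi (- 1 / t / 24) ^ 2 / e2pi (t / 24) ^ 2 = e2pi (- ((t + 1 / t) / 12))"
      unfolding e2pi_power e2pi_diff[symmetric] by (simp add: mult.commute)
    have "R t = e2pi (- 1 / t / 24) ^ 2 / e2pi (t / 24) ^ 2 * (\<phi> (- 1 / t) ^ 2 / (t * \<phi> t ^ 2))"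
      by (simp add: R_def dedekind_eta_altdef \<phi>_def power_mult_distrib)
    also note e
    finally have R3: "R t ^ 3 = e2pi (- ((t + 1 / t) / 12)) ^ 3 * (\<i> * e2pi ((t + 1 / t) / 4))"
      using qpoch_inversion_cubed[OF Im_t] by (simp only: power_mult_distrib \<phi>_def)
    have "of_nat 3 * - ((t + 1 / t) / 12) = - ((t + 1 / t) / 4)"
      by (simp add: field_simps)
    hence "e2pi (- ((t + 1 / t) / 12)) ^ 3 = inverse (e2pi ((t + 1 / t) / 4))"
      by (metis e2pi_power e2pi_minus)
    with R3 show ?thesis by simp
  qed
  have "R holomorphic_on upper_half_plane"
    unfolding R_def using Im_minus_inverse_pos dedekind_eta_nonzero
    by (intro holomorphic_intros holomorphic_on_dedekind_eta open_upper_half_plane)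
       (auto simp: upper_half_plane_def)
  hence "continuous_on upper_half_plane R"
    by (rule holomorphic_on_imp_continuous_on)
  moreover have "finite (R ` upper_half_plane)"
    by (rule finite_subset[of _ "{z. z ^ 3 = \<i>}"]) (use R_cubed finite_nth_roots[of 3 \<i>] in auto)
  ultimately have "R constant_on upper_half_plane"
    using connected_upper_half_plane by (intro continuous_finite_range_constant)
  hence "R \<tau> = R \<i>"
    using assms by (auto simp: constant_on_def upper_half_plane_def)
  also have "R \<i> = - \<i>"
    using dedekind_eta_nonzero[of \<i>] by (simp add: R_def)
  finally have "R \<tau> = - \<i>" .
  moreover have "\<tau> \<noteq> 0" using assms by auto
  ultimately show ?thesis
    using dedekind_eta_nonzero[OF assms] by (simp add: R_def field_simps)
qed

lemma dedekind_eta_inversion_4: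
  assumes "Im \<tau> > 0"
  shows "dedekind_eta (- 1 / \<tau>) ^ 4 = - (\<tau>\<^sup>2) * dedekind_eta \<tau> ^ 4"
  using arg_cong[OF dedekind_eta_inversion_squared[OF assms], of "\<lambda>x. x\<^sup>2"]
  by (simp add: power_mult_distrib flip: power_mult)

lemma dedekind_eta_inversion_8:
  assumes "Im \<tau> > 0"
  shows "dedekind_eta (- 1 / \<tau>) ^ 8 = \<tau> ^ 4 * dedekind_eta \<tau> ^ 8"
  using arg_cong[OF dedekind_eta_inversion_4[OF assms], of "\<lambda>x. x\<^sup>2"]
  by (simp add: power_mult_distrib flip: power_mult)

section \<open>Theta null values and modularity\<close>

text \<open>One sixteenth of the fourth powers of the Jacobi theta null values
  \<open>\<theta>\<^sub>2\<close>, \<open>\<theta>\<^sub>4\<close> and \<open>\<theta>\<^sub>3\<close>.\<close>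

definition th2 :: "complex \<Rightarrow> complex" where
  "th2 z = dedekind_eta (2 * z) ^ 8 / dedekind_eta z ^ 4"

definition th4 :: "complex \<Rightarrow> complex" where
  "th4 z = dedekind_eta (z / 2) ^ 8 / (16 * dedekind_eta z ^ 4)"

definition th3 :: "complex \<Rightarrow> complex" where
  "th3 z = th4 (z + 1)"

lemma dedekind_eta_plus_1_4: "dedekind_eta (z + 1) ^ 4 = e2pi (1 / 6) * dedekind_eta z ^ 4"
  by (simp add: dedekind_eta_plus_1 power_mult_distrib e2pi_power)

lemma dedekind_eta_plus_1_8: "dedekind_eta (z + 1) ^ 8 = e2pi (1 / 3) * dedekind_eta z ^ 8"
  by (simp add: dedekind_eta_plus_1 power_mult_distrib e2pi_power)

lemma th2_plus_1: "th2 (z + 1) = - th2 z"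
proof -
  have "dedekind_eta (2 * (z + 1)) ^ 8 = e2pi (1 / 3) ^ 2 * dedekind_eta (2 * z) ^ 8"
    using dedekind_eta_plus_1_8[of "2 * z + 1"] dedekind_eta_plus_1_8[of "2 * z"]
    by (simp add: power2_eq_square ring_distribs add.assoc)
  moreover have "e2pi (1 / 3) ^ 2 = e2pi (1 / 2) * e2pi (1 / 6)"
    unfolding e2pi_power e2pi_add[symmetric] by (rule arg_cong[of _ _ e2pi]) simp
  ultimately show ?thesis
    by (simp add: th2_def dedekind_eta_plus_1_4)
qed

lemma th2_minus_1: "th2 (z - 1) = - th2 z"
  using th2_plus_1[of "z - 1"] by simp

lemma th4_plus_1: "th4 (z + 1) = th3 z"
  by (simp add: th3_def)

lemma th3_plus_1: "th3 (z + 1) = th4 z"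
proof -
  have "dedekind_eta ((z + 1 + 1) / 2) ^ 8 = e2pi (1 / 6 + 1 / 6) * dedekind_eta (z / 2) ^ 8"
    using dedekind_eta_plus_1_8[of "z / 2"] by (simp add: add_divide_distrib add.assoc)
  moreover have "dedekind_eta (z + 1 + 1) ^ 4 = e2pi (1 / 6 + 1 / 6) * dedekind_eta z ^ 4"
    unfolding dedekind_eta_plus_1_4 e2pi_add by (simp only: mult.assoc)
  ultimately show ?thesis
    unfolding th3_def th4_def by (simp only:) simp
qed

lemma th4_minus_1: "th4 (z - 1) = th3 z"
  using th3_plus_1[of "z - 1"] by simp

lemma th3_minus_1: "th3 (z - 1) = th4 z"
  using th4_plus_1[of "z - 1"] by simp

text \<open>Doubling \<open>- 1 / z\<close> gives \<open>- 1 / (z / 2)\<close>, so the numerator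
  becomes that of \<open>th4\<close>; the 16 in \<open>th4\<close> absorbs the factor
  \<open>(1 / 2) ^ 4\<close>.\<close>

lemma th2_inversion:
  assumes "Im z > 0"
  shows "th2 (- 1 / z) = - (z\<^sup>2) * th4 z"
proof -
  have nz: "z \<noteq> 0" "dedekind_eta z \<noteq> 0"
    using assms dedekind_eta_nonzero by auto
  have "dedekind_eta (2 * (- 1 / z)) ^ 8 = (z / 2) ^ 4 * dedekind_eta (z / 2) ^ 8"
    using dedekind_eta_inversion_8[of "z / 2"] assms by simp
  thus ?thesis
    unfolding th2_def th4_def dedekind_eta_inversion_4[OF assms]
    using nz by (simp add: field_simps flip: power_add)
qed

lemma th4_inversion:
  assumes "Im z > 0"
  shows "th4 (- 1 / z) = - (z\<^sup>2) * th2 z"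
proof -
  have nz: "z \<noteq> 0" "dedekind_eta z \<noteq> 0"
    using assms dedekind_eta_nonzero by auto
  have "dedekind_eta (- 1 / z / 2) ^ 8 = (2 * z) ^ 4 * dedekind_eta (2 * z) ^ 8"
    using dedekind_eta_inversion_8[of "2 * z"] assms by (simp add: mult.commute)
  thus ?thesis
    unfolding th2_def th4_def dedekind_eta_inversion_4[OF assms]
    using nz by (simp add: field_simps flip: power_add)
qed

text \<open>The passage from \<open>(z + 1) / 2\<close> to \<open>(- 1 / z + 1) / 2\<close> is a
  word in inversions and three unit translations. The eighth power of eta picks up
  \<open>e2pi (1 / 3)\<close> from each translation, and the cube of this is 1.\<close>

lemma th3_inversion:
  assumes "Im z > 0"
  shows "th3 (- 1 / z) = - (z\<^sup>2) * th3 z"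
proof -
  have nz: "z \<noteq> 0" "z - 1 \<noteq> 0" "dedekind_eta z \<noteq> 0"
    using assms dedekind_eta_nonzero by auto
  define Y where "Y = (z - 1) / 2"
  define X where "X = - 1 / Y - 1 - 1"
  have Y: "Im Y > 0" "Y \<noteq> 0"
    using assms nz by (auto simp: Y_def)
  have X_eq: "X = - z / Y"
    using nz by (simp add: X_def Y_def field_simps)
  have "Im X = Im (- 1 / Y)"
    by (simp add: X_def)
  hence X: "Im X > 0"
    using Im_minus_inverse_pos[OF Y(1)] by simp
  have "(- 1 / z + 1) / 2 = - 1 / X"
    using nz by (simp add: X_eq Y_def field_simps)
  hence "dedekind_eta ((- 1 / z + 1) / 2) ^ 8 = dedekind_eta (- 1 / X) ^ 8"
    by simp
  also have "\<dots> = X ^ 4 * dedekind_eta X ^ 8"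
    by (rule dedekind_eta_inversion_8[OF X])
  also have "dedekind_eta X ^ 8 = dedekind_eta (- 1 / Y) ^ 8 / e2pi (1 / 3) ^ 2"
    using dedekind_eta_plus_1_8[of X] dedekind_eta_plus_1_8[of "X + 1"]
    by (simp add: X_def power2_eq_square field_simps)
  also have "dedekind_eta (- 1 / Y) ^ 8 = Y ^ 4 * dedekind_eta Y ^ 8"
    by (rule dedekind_eta_inversion_8[OF Y(1)])
  also have "dedekind_eta Y ^ 8 = dedekind_eta ((z + 1) / 2) ^ 8 / e2pi (1 / 3)"
    using dedekind_eta_plus_1_8[of Y] by (simp add: Y_def field_simps)
  also have "X ^ 4 * (Y ^ 4 * (dedekind_eta ((z + 1) / 2) ^ 8 / e2pi (1 / 3)) / e2pi (1 / 3) ^ 2) =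
      (X * Y) ^ 4 * dedekind_eta ((z + 1) / 2) ^ 8 / e2pi (1 / 3) ^ 3"
    by (simp add: power_mult_distrib power2_eq_square power3_eq_cube mult.assoc)
  also have "X * Y = - z"
    using Y by (simp add: X_eq)
  also have "e2pi (1 / 3) ^ 3 = 1"
    by (simp add: e2pi_power)
  finally have "dedekind_eta ((- 1 / z + 1) / 2) ^ 8 = z ^ 4 * dedekind_eta ((z + 1) / 2) ^ 8"
    by simp
  thus ?thesis
    unfolding th3_def th4_def dedekind_eta_plus_1_4 dedekind_eta_inversion_4[OF assms]
    using nz by (simp add: field_simps flip: power_add)
qed

section \<open>The action of the full modular group\<close>

text \<open>Euclid's algorithm on the bottom row. The rules are right multiplications by the
  translation, its inverse and the inversion, written in entries.\<close>

lemma SL2_int_induct [consumes 1, case_names id T T_inv S]: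
  fixes P :: "int \<Rightarrow> int \<Rightarrow> int \<Rightarrow> int \<Rightarrow> bool"
  assumes "a * d - b * c = 1"
    and id: "P 1 0 0 1"
    and T: "\<And>a b c d. a * d - b * c = 1 \<Longrightarrow> P a b c d \<Longrightarrow> P a (b + a) c (d + c)"
    and T_inv: "\<And>a b c d. a * d - b * c = 1 \<Longrightarrow> P a b c d \<Longrightarrow> P a (b - a) c (d - c)"
    and S: "\<And>a b c d. a * d - b * c = 1 \<Longrightarrow> P a b c d \<Longrightarrow> P b (- a) d (- c)"
  shows "P a b c d"
  using assms(1)
proof (induction "nat \<bar>c\<bar>" arbitrary: a b c d rule: less_induct)
  case less
  have T_pow: "P a (b + n * a) c (d + n * c)" if "a * d - b * c = 1" "P a b c d" for a b c d n
  proof (induction n rule: int_induct[where k = 0])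
    case (step1 n)
    have "a * (d + n * c) - (b + n * a) * c = 1"
      using that(1) by (simp add: algebra_simps)
    from T[OF this step1(2)] show ?case by (simp add: algebra_simps)
  next
    case (step2 n)
    have "a * (d + n * c) - (b + n * a) * c = 1"
      using that(1) by (simp add: algebra_simps)
    from T_inv[OF this step2(2)] show ?case by (simp add: algebra_simps)
  qed (use that in simp)
  \<comment> \<open>The square of the inversion matrix is minus the identity.\<close>
  have S2: "P (- a) (- b) (- c) (- d)" if "a * d - b * c = 1" "P a b c d" for a b c d
    using S[of b "- c" "- a" d] S[of a d b c] that by (simp add: algebra_simps)
  show ?case
  proof (cases "c = 0")
    case True
    with less.prems have "a = 1 \<and> d = 1 \<or> a = -1 \<and> d = -1"
      by (auto simp: zmult_eq_1_iff)
    thus ?thesis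
      using T_pow[OF _ id, of b] S2[OF _ T_pow[OF _ id, of "- b"]] True by auto
  next
    case False
    define n where "n = d div c"
    have d: "d - n * c = d mod c"
      by (simp add: n_def minus_div_mult_eq_mod)
    have det: "(b - n * a) * (- c) - (- a) * (d - n * c) = 1"
      using less.prems by (simp add: algebra_simps)
    \<comment> \<open>Subtracting \<open>n\<close> times the first column and swapping leaves
      \<open>d mod c\<close> in the corner, so the induction hypothesis applies; the steps are then
      undone with \<open>S2\<close>, \<open>S\<close> and \<open>T_pow\<close>.\<close>
    have "P (b - n * a) (- a) (d - n * c) (- c)"
    proof (rule less.hyps[OF _ det])
      show "nat \<bar>d - n * c\<bar> < nat \<bar>c\<bar>"
        unfolding d using abs_mod_less[OF False, of d] by simp
    qed
    from S2[OF det this] have "P (- (b - n * a)) a (- (d - n * c)) c" by simp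
    from S[OF _ this] have "P a (b - n * a) c (d - n * c)"
      using det by (simp add: algebra_simps)
    from T_pow[OF _ this, of n] show ?thesis
      using det by (simp add: algebra_simps)
  qed
qed

lemma automorphy_denominator_nonzero:
  fixes a b c d :: int
  assumes "a * d - b * c = 1" "Im z > 0"
  shows "of_int c * z + of_int d \<noteq> 0"
proof
  assume *: "of_int c * z + of_int d = 0"
  hence "Im (of_int c * z + of_int d) = 0" by simp
  hence "c = 0" using assms(2) by simp
  with * assms(1) show False by simp
qed

text \<open>Right multiplication by a generator replaces \<open>z\<close> by \<open>z + 1\<close>,
  \<open>z - 1\<close> or \<open>- 1 / z\<close>, where the induction hypothesis is applied. Signs
  and null values depend only on parities, and the odd determinant excludes the inconsistent
  ones.\<close>

lemma th2_SL2:
  fixes a b c d :: int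
  assumes "a * d - b * c = 1" "Im z > 0"
  shows "th2 ((of_int a * z + of_int b) / (of_int c * z + of_int d)) =
    (of_int c * z + of_int d)\<^sup>2 *
      (if even c then (if even b then th2 z else - th2 z)
       else (if even a then -1 else 1) * (if even d then th4 z else th3 z))"
  using assms
proof (induction a b c d arbitrary: z rule: SL2_int_induct)
  case id
  thus ?case by simp
next
  case (T a b c d)
  have parity: "odd (a * d - b * c)" using T.hyps by simp
  have eq: "of_int a * (z + 1) + of_int b = of_int a * z + of_int (b + a)"
    "of_int c * (z + 1) + of_int d = of_int c * z + of_int (d + c)"
    by (simp_all add: algebra_simps)
  show ?case
    using T.IH[of "z + 1"] T.prems parity unfolding eq
    by (auto simp del: of_int_add of_int_diff simp: th2_plus_1 th3_plus_1 th4_plus_1)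
next
  case (T_inv a b c d)
  have parity: "odd (a * d - b * c)" using T_inv.hyps by simp
  have eq: "of_int a * (z - 1) + of_int b = of_int a * z + of_int (b - a)"
    "of_int c * (z - 1) + of_int d = of_int c * z + of_int (d - c)"
    by (simp_all add: algebra_simps)
  show ?case
    using T_inv.IH[of "z - 1"] T_inv.prems parity unfolding eq
    by (auto simp del: of_int_add of_int_diff simp: th2_minus_1 th3_minus_1 th4_minus_1)
next
  case (S a b c d)
  have nz: "z \<noteq> 0" using S.prems by auto
  have z': "Im (- 1 / z) > 0" using Im_minus_inverse_pos S.prems by simp
  have parity: "odd (a * d - b * c)" using S.hyps by simp
  have den: "of_int c * (- 1 / z) + of_int d = (of_int d * z - of_int c) / z"
    using nz by (simp add: field_simps)
  have eq: "(of_int a * (- 1 / z) + of_int b) / (of_int c * (- 1 / z) + of_int d) =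
      (of_int b * z - of_int a) / (of_int d * z - of_int c)"
  proof -
    have "of_int a * (- 1 / z) + of_int b = (of_int b * z - of_int a) / z"
      using nz by (simp add: field_simps)
    thus ?thesis unfolding den using nz by simp
  qed
  show ?case
    using S.IH[OF z'] parity nz
    unfolding eq th2_inversion[OF S.prems] th3_inversion[OF S.prems] th4_inversion[OF S.prems]
    unfolding den by (auto simp: power_divide)
qed

section \<open>Expansions at infinity\<close>

lemma th2_q_expansion:
  obtains g where "g holomorphic_on ball 0 1" "\<And>z. Im z > 0 \<Longrightarrow> th2 z = g (e2pi (z / 2))"
proof
  \<comment> \<open>With \<open>r = e2pi (z / 2)\<close>, the nomes of \<open>2 * z\<close> and
    \<open>z\<close> are \<open>r ^ 4\<close> and \<open>r ^ 2\<close>; the leading exponentials of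
    eta combine to the single factor \<open>r\<close>.\<close>
  define g where "g = (\<lambda>r. r * qpoch (r ^ 4) (r ^ 4) ^ 8 / qpoch (r ^ 2) (r ^ 2) ^ 4)"
  show "g holomorphic_on ball 0 1"
    unfolding g_def using qpoch_self_nonzero
    by (intro holomorphic_intros holomorphic_on_qpoch)
       (auto simp: norm_power power_less_one_iff)
  fix z :: complex assume "Im z > 0"
  have "e2pi (2 * z / 24) ^ 8 / e2pi (z / 24) ^ 4 = e2pi (z / 2)"
    unfolding e2pi_power e2pi_diff[symmetric] by (rule arg_cong[of _ _ e2pi]) simp
  thus "th2 z = g (e2pi (z / 2))"
    by (simp add: th2_def g_def dedekind_eta_altdef power_mult_distrib e2pi_power field_simps)
qed

lemma th4_q_expansion:
  obtains g where "g holomorphic_on ball 0 1" "\<And>z. Im z > 0 \<Longrightarrow> th4 z = g (e2pi (z / 2))"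
proof
  define g where "g = (\<lambda>r. qpoch r r ^ 8 / (16 * qpoch (r ^ 2) (r ^ 2) ^ 4))"
  show "g holomorphic_on ball 0 1"
    unfolding g_def using qpoch_self_nonzero
    by (intro holomorphic_intros holomorphic_on_qpoch)
       (auto simp: norm_power power_less_one_iff)
  fix z :: complex assume "Im z > 0"
  thus "th4 z = g (e2pi (z / 2))"
    by (simp add: th4_def g_def dedekind_eta_altdef power_mult_distrib e2pi_power)
qed

lemma th3_q_expansion:
  obtains g where "g holomorphic_on ball 0 1" "\<And>z. Im z > 0 \<Longrightarrow> th3 z = g (e2pi (z / 2))"
proof -
  obtain g where g: "g holomorphic_on ball 0 1" "\<And>z. Im z > 0 \<Longrightarrow> th4 z = g (e2pi (z / 2))"
    using th4_q_expansion by blast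
  \<comment> \<open>Translating \<open>z\<close> by 1 changes the sign of
    \<open>e2pi (z / 2)\<close>.\<close>
  have "g \<circ> uminus holomorphic_on ball 0 1"
    by (intro holomorphic_on_compose holomorphic_intros holomorphic_on_subset[OF g(1)]) auto
  moreover have "th3 z = (g \<circ> uminus) (e2pi (z / 2))" if "Im z > 0" for z
    using g(2)[of "z + 1"] that by (simp add: th3_def add_divide_distrib e2pi_add)
  ultimately show ?thesis by (rule that)
qed

lemma th2_SL2_q_expansion:
  fixes a b c d :: int
  assumes "a * d - b * c = 1"
  obtains g where "g holomorphic_on ball 0 1"
    "\<And>z. Im z > 0 \<Longrightarrow> th2 ((of_int a * z + of_int b) / (of_int c * z + of_int d)) =
       (of_int c * z + of_int d)\<^sup>2 * g (e2pi (z / 2))"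
proof -
  obtain s f where sf: "\<And>z. Im z > 0 \<Longrightarrow>
      th2 ((of_int a * z + of_int b) / (of_int c * z + of_int d)) = (of_int c * z + of_int d)\<^sup>2 * (s * f z)"
    and f: "f \<in> {th2, th3, th4}"
  proof
    show "th2 ((of_int a * z + of_int b) / (of_int c * z + of_int d)) = (of_int c * z + of_int d)\<^sup>2 *
        ((if even c then (if even b then 1 else -1) else (if even a then -1 else 1)) *
          (if even c then th2 else if even d then th4 else th3) z)" if "Im z > 0" for z
      using th2_SL2[OF assms that] by simp
  qed auto
  obtain g where "g holomorphic_on ball 0 1" "\<And>z. Im z > 0 \<Longrightarrow> f z = g (e2pi (z / 2))"
    using f th2_q_expansion th3_q_expansion th4_q_expansion by (elim insertE emptyE) metis+
  thus ?thesis
    by (intro that[of "\<lambda>x. s * g x"]) (auto simp: sf intro!: holomorphic_intros)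
qed

section \<open>Passage to level \<open>4 * p\<close>\<close>

text \<open>This factors the matrix with rows \<open>N * a\<close>, \<open>N * b\<close> and
  \<open>c\<close>, \<open>d\<close>: its first column divided by the gcd is primitive, and Bezout
  completes it to determinant 1.\<close>

lemma SL2_diag_decomposition:
  fixes a b c d N :: int
  assumes det: "a * d - b * c = 1" and N: "N > 0"
  obtains x u y v \<alpha> \<beta> \<delta> :: int
  where "x * v - u * y = 1" "\<alpha> > 0" "\<delta> > 0"
    "N * a = x * \<alpha>" "N * b = x * \<beta> + u * \<delta>" "c = y * \<alpha>" "d = y * \<beta> + v * \<delta>"
proof -
  define g where "g = gcd (N * a) c"
  have "N * a \<noteq> 0 \<or> c \<noteq> 0" using assms by auto
  hence g: "g > 0" by (simp add: g_def)
  obtain x y where xy: "N * a = x * g" "c = y * g"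
    by (metis g_def gcd_dvd1 gcd_dvd2 dvd_def mult.commute)
  have "gcd (x * g) (y * g) = g" using g_def xy by metis
  hence "coprime x y"
    using g by (simp add: gcd_mult_right coprime_iff_gcd_eq_1 gcd.commute)
  then obtain v t where vt: "v * x + t * y = 1"
    using bezout_int[of x y] by auto
  define u where "u = - t"
  \<comment> \<open>The second column of the triangular factor is the inverse of the unimodular
    factor applied to \<open>N * b\<close> and \<open>d\<close>.\<close>
  define \<beta> where "\<beta> = v * (N * b) - u * d"
  define \<delta> where "\<delta> = x * d - y * (N * b)"
  have one: "x * v - u * y = 1" using vt by (simp add: u_def algebra_simps)
  have "g * \<delta> = N * (a * d - b * c)"
    unfolding \<delta>_def right_diff_distrib using xy by (simp add: algebra_simps)
  hence "\<delta> > 0"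
    using g N det by (metis mult.right_neutral zero_less_mult_pos)
  moreover have "x * \<beta> + u * \<delta> = (x * v - u * y) * (N * b)" "y * \<beta> + v * \<delta> = (x * v - u * y) * d"
    by (simp_all add: \<beta>_def \<delta>_def algebra_simps)
  ultimately show ?thesis
    using one xy g by (intro that[of x v u y g \<delta> \<beta>]) simp_all
qed

lemma SL2Z_det: "A \<in> SL2Z \<Longrightarrow> A $ 1 $ 1 * A $ 2 $ 2 - A $ 1 $ 2 * A $ 2 $ 1 = 1"
  by (simp add: SL2Z_def det_2)

theorem proposition5p11:
  fixes p k :: nat
  assumes "prime p" and "even k" and "k > 0"
  shows "(\<lambda>z. dedekind_eta (4 * of_nat p * z) ^ (4 * k) / dedekind_eta (2 * of_nat p * z) ^ (2 * k))
           \<in> modular_forms (int k) (Gamma0 (4 * p))"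
proof -
  obtain m where k: "k = 2 * m" using \<open>even k\<close> by blast
  define N where "N = 2 * int p"
  have N: "N > 0" using prime_gt_0_nat[OF \<open>prime p\<close>] by (simp add: N_def)
  define f where "f = (\<lambda>z. dedekind_eta (4 * of_nat p * z) ^ (4 * k) / dedekind_eta (2 * of_nat p * z) ^ (2 * k))"
  have f_th2: "f z = th2 (of_int N * z) ^ m" for z
    by (simp add: f_def th2_def N_def k power_divide mult.assoc flip: power_mult)
  have Im_N: "Im (of_int N * z) > 0" if "z \<in> upper_half_plane" for z
    using that N by (simp add: upper_half_plane_def)
  \<comment> \<open>A relation of weight 2 for \<open>th2\<close> becomes one of weight
    \<open>k = 2 * m\<close> for its power \<open>f\<close>.\<close>
  have slash_f: "slash (int k) A f z = F ^ m"
    if A: "A \<in> SL2Z" and z: "z \<in> upper_half_plane"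
      and F: "th2 (of_int N * moebius A z) = (automorphy_factor A z)\<^sup>2 * F" for A z F
  proof -
    have "automorphy_factor A z \<noteq> 0"
      using automorphy_denominator_nonzero[OF SL2Z_det[OF A]] z
      by (simp add: automorphy_factor_def upper_half_plane_def)
    moreover have "automorphy_factor A z powi (- int k) = inverse (automorphy_factor A z ^ (2 * m))"
      unfolding k by (simp only: power_int_minus power_int_of_nat)
    ultimately show ?thesis
      by (simp add: slash_def f_th2 F power_mult_distrib flip: power_mult)
  qed

  have "f holomorphic_on upper_half_plane"
    unfolding f_def using Im_N dedekind_eta_nonzero
    by (intro holomorphic_intros holomorphic_on_dedekind_eta open_upper_half_plane)
       (auto simp: N_def upper_half_plane_def)
  moreover have "slash (int k) A f z = f z" if A: "A \<in> Gamma0 (4 * p)" and z: "z \<in> upper_half_plane" for A z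
  proof -
    define a b c d where "a = A $ 1 $ 1" and "b = A $ 1 $ 2" and "c = A $ 2 $ 1" and "d = A $ 2 $ 2"
    have SL: "A \<in> SL2Z" and "int (4 * p) dvd c"
      using A by (auto simp: Gamma0_def c_def)
    then obtain c' where "c = int (4 * p) * c'"
      by (auto elim: dvdE)
    hence c': "c = N * (2 * c')"
      by (simp add: N_def)
    \<comment> \<open>Conjugation by multiplication with \<open>N\<close> gives off-diagonal entries
      \<open>N * b\<close> and \<open>2 * c'\<close>, both even, so \<open>th2_SL2\<close> returns
      \<open>th2\<close> with sign plus.\<close>
    have det: "a * d - (N * b) * (2 * c') = 1"
      using SL2Z_det[OF SL] by (simp add: a_def b_def d_def c' mult_ac flip: c_def)
    have den: "of_int (2 * c') * (of_int N * z) + of_int d = automorphy_factor A z"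
      by (simp add: automorphy_factor_def c' flip: c_def d_def)
    have "of_int N * moebius A z = (of_int a * (of_int N * z) + of_int (N * b)) / (of_int (2 * c') * (of_int N * z) + of_int d)"
      unfolding den by (simp add: moebius_def a_def b_def algebra_simps)
    hence "th2 (of_int N * moebius A z) = (automorphy_factor A z)\<^sup>2 * th2 (of_int N * z)"
      using th2_SL2[OF det Im_N[OF z]] unfolding den by (simp add: N_def)
    from slash_f[OF SL z this] show ?thesis by (simp add: f_th2)
  qed
  moreover have "holomorphic_at_ii_inf (slash (int k) A f)" if A: "A \<in> SL2Z" for A
  proof -
    define a b c d where "a = A $ 1 $ 1" and "b = A $ 1 $ 2" and "c = A $ 2 $ 1" and "d = A $ 2 $ 2"
    have "a * d - b * c = 1"
      using SL2Z_det[OF A] by (simp add: a_def b_def c_def d_def)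
    then obtain x u y v \<alpha> \<beta> \<delta> :: int where
      det: "x * v - u * y = 1" and pos: "\<alpha> > 0" "\<delta> > 0"
      and eqs: "N * a = x * \<alpha>" "N * b = x * \<beta> + u * \<delta>" "c = y * \<alpha>" "d = y * \<beta> + v * \<delta>"
      using SL2_diag_decomposition[OF _ N] by metis
    obtain g where g: "g holomorphic_on ball 0 1"
      "\<And>z. Im z > 0 \<Longrightarrow> th2 ((of_int x * z + of_int u) / (of_int y * z + of_int v)) =
         (of_int y * z + of_int v)\<^sup>2 * g (e2pi (z / 2))"
      using th2_SL2_q_expansion[OF det] by blast
    \<comment> \<open>The expansion variable is \<open>e2pi (w / 2)\<close> with
      \<open>w = (\<alpha> * z + \<beta>) / \<delta>\<close>, hence the period
      \<open>2 * \<delta>\<close>; \<open>\<beta>\<close> contributes only the constant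
      \<open>\<zeta>\<close> of norm 1.\<close>
    define h where "h = nat (2 * \<delta>)"
    define \<zeta> where "\<zeta> = e2pi (of_int \<beta> / of_nat h)"
    \<comment> \<open>The division by \<open>of_int \<delta> ^ 2\<close> arises because the
      automorphy factor at \<open>w\<close> is that of \<open>A\<close> at \<open>z\<close> divided
      by \<open>\<delta>\<close>.\<close>
    define G where "G = (\<lambda>q. (g (\<zeta> * q ^ nat \<alpha>) / of_int \<delta> ^ 2) ^ m)"
    have h: "h > 0" "of_nat h = (2 * of_int \<delta> :: complex)"
      using pos by (auto simp: h_def)
    have "norm \<zeta> = 1"
      by (simp add: \<zeta>_def norm_e2pi h(2))
    hence "g \<circ> (\<lambda>q. \<zeta> * q ^ nat \<alpha>) holomorphic_on ball 0 1"
      using pos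
      by (intro holomorphic_on_compose holomorphic_intros holomorphic_on_subset[OF g(1)])
         (auto simp: norm_mult norm_power power_less_one_iff)
    hence "G holomorphic_on ball 0 1"
      unfolding G_def o_def using pos by (intro holomorphic_intros) auto
    moreover have "slash (int k) A f z = G (exp (2 * of_real pi * \<i> * z / of_nat h))"
      if z: "z \<in> upper_half_plane" for z
    proof -
      define w where "w = (of_int \<alpha> * z + of_int \<beta>) / (of_int \<delta> :: complex)"
      have w: "Im w > 0"
        using z pos by (simp add: w_def upper_half_plane_def)
      have den: "of_int y * w + of_int v = automorphy_factor A z / of_int \<delta>"
        using pos eqs by (simp add: w_def automorphy_factor_def field_simps flip: c_def d_def)
      have num: "of_int x * w + of_int u = of_int N * (of_int a * z + of_int b) / of_int \<delta>"
      proof -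
        have "of_int N * (of_int a * z + of_int b) = of_int (N * a) * z + of_int (N * b)"
          by (simp add: algebra_simps)
        also have "\<dots> = of_int \<delta> * (of_int x * w + of_int u)"
          unfolding eqs using pos by (simp add: w_def field_simps)
        finally show ?thesis using pos by simp
      qed
      have "of_int N * moebius A z = (of_int x * w + of_int u) / (of_int y * w + of_int v)"
        unfolding num den using pos by (simp add: moebius_def a_def b_def)
      hence "th2 (of_int N * moebius A z) = (automorphy_factor A z)\<^sup>2 * (g (e2pi (w / 2)) / of_int \<delta> ^ 2)"
        using g(2)[OF w] unfolding den by (simp add: power_divide)
      moreover have "of_int \<beta> / of_nat h + of_nat (nat \<alpha>) * (z / of_nat h) = w / 2"
        unfolding h(2) w_def using pos by (simp add: field_simps)
      hence "e2pi (w / 2) = \<zeta> * e2pi (z / of_nat h) ^ nat \<alpha>"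
        by (metis \<zeta>_def e2pi_add e2pi_power)
      ultimately show ?thesis
        using slash_f[OF A z] by (simp add: G_def e2pi_def)
    qed
    ultimately show ?thesis
      unfolding holomorphic_at_ii_inf_def using h(1) by blast
  qed
  ultimately show ?thesis
    by (simp add: modular_forms_def f_def)
qed

end
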